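(* For all integers $k\ge 2$ and $m\ge 2$, there is a strongly connected, $k$-regular digraph on $mk$ vertices with an edge-labelling by $\mathbb{Z}_k$ and no zero-sum directed cycle.
   Context: All digraphs are finite, simple and loopless: for each ordered pair $(u,v)$ there is at most one edge from $u$ to $v$, there are no edges from a vertex to itself, and both opposite edges $uv$ and $vu$ may be present. A digraph is $k$-regular if every vertex has outdegree $k$ and indegree $k$. A directed cycle $C=v_1v_2\cdots v_\ell v_1$ has distinct vertices $v_1,\dots,v_\ell$ and all displayed edges in the digraph (so $\ell\ge 2$). $\mathbb{Z}_k$ is the cyclic group of integers modulo $k$ under addition. For an edge-labelling by $\mathbb{Z}_k$, a directed cycle is zero-sum if the sum of its edge labels is $0$ in $\mathbb{Z}_k$. *)

theory Defs
  imports "Graph_Theory.Graph_Theory" "HOL-Algebra.Elementary_Groups"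
begin

definition regular_digraph :: "nat \<Rightarrow> ('a, 'b) pre_digraph \<Rightarrow> bool" where
  "regular_digraph k G \<longleftrightarrow>
     digraph G \<and> (\<forall>v\<in>verts G. out_degree G v = k \<and> in_degree G v = k)"

text \<open>The cyclic group of order \<open>k\<close> is the library's \<^const>\<open>integer_mod_group\<close>, which is written
  multiplicatively: its operation is addition modulo \<open>k\<close> and its unit is \<open>0\<close>.\<close>

definition edge_labelling :: "nat \<Rightarrow> ('a, 'b) pre_digraph \<Rightarrow> ('b \<Rightarrow> int) \<Rightarrow> bool" where
  "edge_labelling k G w \<longleftrightarrow> (\<forall>e\<in>arcs G. w e \<in> carrier (integer_mod_group k))"

definition label_sum :: "nat \<Rightarrow> ('b \<Rightarrow> int) \<Rightarrow> 'b list \<Rightarrow> int" where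
  "label_sum k w p =
     foldr (mult (integer_mod_group k)) (map w p) (one (integer_mod_group k))"

text \<open>The library represents a directed cycle by its list of arcs. In a loopfree digraph every
  \<^const>\<open>pre_digraph.cycle\<close> has length at least two (lemma \<open>cycle_digraph_conv\<close>),
  and opposite arcs \<open>uv\<close>, \<open>vu\<close> form a cycle.\<close>

definition zero_sum_cycle ::
    "nat \<Rightarrow> ('a, 'b) pre_digraph \<Rightarrow> ('b \<Rightarrow> int) \<Rightarrow> 'b list \<Rightarrow> bool" where
  "zero_sum_cycle k G w p \<longleftrightarrow>
     pre_digraph.cycle G p \<and> label_sum k w p = one (integer_mod_group k)"

end

theory Submission
  imports Defs
begin

text \<open>
  Arrange \<open>m\<close> blocks of \<open>k\<close> vertices in a cycle, and let each block have one special vertex. There are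
  arcs from the special vertex of a block to the other vertices of that block and to the special
  vertex of the next block, and from every other vertex to all of the next block. Order the vertices
  block by block, the special vertex first in its block, and label an arc by \<open>0\<close> if it ascends and
  by \<open>1\<close> if it descends, that is, if it returns from the last block to the first one.

  A closed walk has at least one descent. If it has \<open>s\<close> descents, it winds \<open>s\<close> times around, so
  that it uses exactly \<open>m s\<close> arcs between blocks. A cycle has at most \<open>m k\<close> arcs, whence
  \<open>s \<le> k\<close>. If \<open>s = k\<close>, then the cycle is Hamiltonian and uses only arcs between blocks; but these
  never leave the set of special vertices. Hence \<open>0 < s < k\<close>.
\<close>

lemma label_sum_eq_sum_list:
  assumes "k > 0"
  shows "label_sum k w p = sum_list (map w p) mod int k"
  unfolding label_sum_def by (induction p) (simp_all add: mod_add_right_eq)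

section \<open>Sums and invariants along walks\<close>

context pre_digraph
begin

text \<open>The potential \<open>f\<close> telescopes along the walk. Writing its change as
  \<open>g\<close> on one side and \<open>h\<close> on the other avoids subtraction, so that it
  applies to natural numbers.\<close>

lemma cas_telescope:
  fixes f :: "'a \<Rightarrow> 'c::comm_monoid_add"
  assumes "cas u p v"
    and "\<And>e. e \<in> set p \<Longrightarrow> f (tail G e) + g e = f (head G e) + h e"
  shows "f u + sum_list (map g p) = f v + sum_list (map h p)"
  using assms
proof (induction p arbitrary: u)
  case (Cons e p)
  then have "f u + g e = f (head G e) + h e" by auto
  moreover have "f (head G e) + sum_list (map g p) = f v + sum_list (map h p)"
    using Cons by auto
  ultimately have "f u + g e + sum_list (map g p) = h e + (f v + sum_list (map h p))"
    by (metis add.assoc add.commute)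
  then show ?case by (simp add: ac_simps)
qed simp

lemma cas_ascending:
  fixes u v :: 'a and r :: "'a \<Rightarrow> 'c::order"
  assumes "cas u p v" "p \<noteq> []"
    and "\<And>e. e \<in> set p \<Longrightarrow> r (tail G e) < r (head G e)"
  shows "r u < r v"
  using assms
proof (induction p arbitrary: u)
  case (Cons e p)
  show ?case
  proof (cases "p = []")
    case False
    then have "r (head G e) < r v" using Cons by auto
    moreover have "r u < r (head G e)" using Cons.prems by auto
    ultimately show ?thesis by order
  qed (use Cons.prems in auto)
qed simp

lemma cas_invariant:
  assumes "cas u p v" "P u"
    and "\<And>e. e \<in> set p \<Longrightarrow> P (tail G e) \<Longrightarrow> P (head G e)"
  shows "P v"
  using assms by (induction p arbitrary: u) auto

text \<open>Follow the walk from the head of \<open>e\<close> to its end \<open>u\<close>, then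
  start again at \<open>u\<close>: this second round meets \<open>f\<close>, whether
  \<open>f\<close> lies before or after \<open>e\<close>.\<close>

lemma closed_cas_invariant:
  assumes cas: "cas u p u" and "e \<in> set p" "f \<in> set p" and e: "P (head G e)"
    and step: "\<And>e. e \<in> set p \<Longrightarrow> P (tail G e) \<Longrightarrow> P (head G e)"
  shows "P (head G f)"
proof -
  obtain q r where p: "p = q @ e # r" using \<open>e \<in> set p\<close> by (meson split_list)
  have "cas (head G e) r u" using cas by (simp add: p)
  then have u: "P u" using e by (rule cas_invariant) (auto simp: p intro: step)
  obtain q' r' where p': "p = q' @ f # r'" using \<open>f \<in> set p\<close> by (meson split_list)
  have "cas u (q' @ [f]) (head G f)" using cas by (simp add: p')
  then show ?thesis using u by (rule cas_invariant) (auto simp: p' intro: step)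
qed

text \<open>Through this, the distinctness of the vertices of a cycle becomes distinctness of the
  heads of its arcs.\<close>

lemma awalk_verts_eq_heads: "cas u p v \<Longrightarrow> awalk_verts u p = u # map (head G) p"
  by (induction p arbitrary: u) auto

end

section \<open>The digraph of blocks\<close>

locale block_cycle =
  fixes k m :: nat
  assumes k_ge_2: "k \<ge> 2" and m_ge_2: "m \<ge> 2"
begin

definition block :: "nat \<Rightarrow> nat set" where
  "block i = {i * k..<i * k + k}"

definition next_block :: "nat \<Rightarrow> nat" where
  "next_block i = (if Suc i = m then 0 else Suc i)"

definition prev_block :: "nat \<Rightarrow> nat" where
  "prev_block i = (if i = 0 then m - 1 else i - 1)"

text \<open>The special vertices are the multiples of \<open>k\<close>.\<close>

definition out_nbs :: "nat \<Rightarrow> nat set" where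
  "out_nbs x =
     (if k dvd x then insert (next_block (x div k) * k) (block (x div k) - {x})
      else block (next_block (x div k)))"

definition G :: "(nat, nat \<times> nat) pre_digraph" where
  "G = \<lparr>verts = {..<m * k}, arcs = Sigma {..<m * k} out_nbs, tail = fst, head = snd\<rparr>"

definition descent :: "nat \<times> nat \<Rightarrow> nat" where
  "descent e = (if fst e < snd e then 0 else 1)"

lemma G_simps [simp]:
  "verts G = {..<m * k}" "arcs G = Sigma {..<m * k} out_nbs" "tail G = fst" "head G = snd"
  by (simp_all add: G_def)

lemma mem_block_iff: "x \<in> block i \<longleftrightarrow> x div k = i"
proof
  assume "x \<in> block i"
  then show "x div k = i"
    unfolding block_def by (intro div_nat_eqI) (auto simp: mult.commute)
next
  assume "x div k = i"
  then show "x \<in> block i"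
    using k_ge_2 dividend_less_div_times[of k x] by (auto simp: block_def add.commute)
qed

lemma card_block [simp]: "card (block i) = k"
  by (simp add: block_def)

lemma finite_block [simp]: "finite (block i)"
  by (simp add: block_def)

lemma mult_k_mem_block [simp]: "i * k \<in> block j \<longleftrightarrow> i = j"
  using k_ge_2 by (auto simp: mem_block_iff)

lemma eq_mult_k_iff: "x = i * k \<longleftrightarrow> x div k = i \<and> k dvd x"
  using k_ge_2 by auto

lemma less_verts_iff: "x < m * k \<longleftrightarrow> x div k < m"
  using k_ge_2 by (simp add: div_less_iff_less_mult)

lemma next_block_less: "next_block i < m" if "i < m"
  using that m_ge_2 by (auto simp: next_block_def)

lemma prev_block_less: "prev_block i < m" if "i < m"
  using that m_ge_2 by (auto simp: prev_block_def)

lemma next_block_neq: "next_block i \<noteq> i"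
  using m_ge_2 by (auto simp: next_block_def)

lemma next_block_eq_iff: "i < m \<Longrightarrow> j < m \<Longrightarrow> next_block i = j \<longleftrightarrow> i = prev_block j"
  by (auto simp: next_block_def prev_block_def)

text \<open>A block contains just one multiple of \<open>k\<close>. Hence removing \<open>x\<close>
  from its block, or picking the special vertex of the next block, amounts to a divisibility
  condition.\<close>

lemma mem_out_nbs_iff:
  "y \<in> out_nbs x \<longleftrightarrow>
     k dvd x \<and> y div k = x div k \<and> \<not> k dvd y \<or>
     y div k = next_block (x div k) \<and> (k dvd x \<longrightarrow> k dvd y)"
  using k_ge_2 by (auto simp: out_nbs_def mem_block_iff)

lemma out_nbs_less: "x < m * k \<Longrightarrow> y \<in> out_nbs x \<Longrightarrow> y < m * k"
  by (auto simp: mem_out_nbs_iff less_verts_iff next_block_less)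

lemma digraph_G: "digraph G"
proof
  show "finite (arcs G)"
    by (auto simp: out_nbs_def intro!: finite_SigmaI)
qed (auto simp: out_nbs_less arc_to_ends_def mem_out_nbs_iff next_block_neq[symmetric])

sublocale digraph G
  by (rule digraph_G)

section \<open>Degrees\<close>

lemma out_degree_G:
  assumes "x < m * k"
  shows "out_degree G x = k"
proof -
  have "out_arcs G x = Pair x ` out_nbs x"
    using assms by (auto simp: out_arcs_def)
  then have "out_degree G x = card (out_nbs x)"
    by (simp add: out_degree_def card_image inj_on_def)
  also have "\<dots> = k"
  proof (cases "k dvd x")
    case True
    have "x \<in> block (x div k)" by (simp add: mem_block_iff)
    \<comment> \<open>The arc to the next block makes up for the removed \<open>x\<close>, as the
      two blocks are disjoint.\<close>
    moreover have "next_block (x div k) * k \<notin> block (x div k)"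
      by (simp add: next_block_neq)
    ultimately show ?thesis
      using True k_ge_2 by (simp add: out_nbs_def card_insert_if)
  qed (simp add: out_nbs_def)
  finally show ?thesis .
qed

lemma in_degree_G:
  assumes "y < m * k"
  shows "in_degree G y = k"
proof -
  define i where "i = y div k"
  define j where "j = prev_block i"
  \<comment> \<open>A special \<open>y\<close> is entered from the whole previous block
    \<open>j\<close>; any other \<open>y\<close> from the special vertex of its own block
    \<open>i\<close> and from the \<open>k - 1\<close> nonspecial vertices of block
    \<open>j\<close>.\<close>
  define N where "N = (if k dvd y then block j else insert (i * k) (block j - {j * k}))"
  have i: "i < m" using assms by (simp add: i_def less_verts_iff)
  then have j: "j < m" by (simp add: j_def prev_block_less)
  have nb: "i = next_block a \<longleftrightarrow> a = j" if "a < m" for a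
    using next_block_eq_iff[OF that i] by (auto simp: j_def)
  have ij: "i \<noteq> j" using nb[OF j] next_block_neq by metis
  have "x < m * k \<and> y \<in> out_nbs x \<longleftrightarrow> x \<in> N" for x
  proof -
    have "x \<in> N \<longleftrightarrow> (if k dvd y then x div k = j
        else x div k = i \<and> k dvd x \<or> x div k = j \<and> \<not> k dvd x)"
      by (auto simp: N_def mem_block_iff eq_mult_k_iff)
    moreover have "x < m * k \<and> y \<in> out_nbs x \<longleftrightarrow> x div k < m \<and>
        (k dvd x \<and> i = x div k \<and> \<not> k dvd y \<or> x div k = j \<and> (k dvd x \<longrightarrow> k dvd y))"
      using nb by (auto simp: mem_out_nbs_iff less_verts_iff i_def[symmetric])
    ultimately show ?thesis using i j by auto
  qed
  then have N: "{x. x < m * k \<and> y \<in> out_nbs x} = N" by blast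
  have "in_arcs G y = (\<lambda>x. (x, y)) ` {x. x < m * k \<and> y \<in> out_nbs x}"
    by (auto simp: in_arcs_def)
  then have "in_degree G y = card N"
    by (simp add: in_degree_def card_image inj_on_def N)
  also have "\<dots> = k"
    using k_ge_2 ij by (auto simp: N_def card_insert_if)
  finally show ?thesis .
qed

lemma regular_digraph_G: "regular_digraph k G"
  unfolding regular_digraph_def using digraph_G out_degree_G in_degree_G by auto

section \<open>Strong connectivity\<close>

lemma adjI: "x < m * k \<Longrightarrow> y \<in> out_nbs x \<Longrightarrow> x \<rightarrow>\<^bsub>G\<^esub> y"
  by (force simp: arcs_ends_def arc_to_ends_def)

lemma special_reach:
  assumes "i \<le> j" "j < m"
  shows "(i * k) \<rightarrow>\<^sup>*\<^bsub>G\<^esub> (j * k)"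
  using assms
proof (induction j rule: dec_induct)
  case base
  then show ?case using k_ge_2 by simp
next
  case (step j)
  have "(j * k) \<rightarrow>\<^bsub>G\<^esub> (Suc j * k)"
    using step k_ge_2 by (intro adjI) (auto simp: less_verts_iff mem_out_nbs_iff next_block_def)
  then show ?case using step by (simp add: reachable_adj_trans)
qed

text \<open>Every vertex has an arc to the special vertex of the next block. From there the special
  vertices lead up to the last block, and one more arc wraps around to 0.\<close>

lemma reach_0:
  assumes "x < m * k"
  shows "x \<rightarrow>\<^sup>*\<^bsub>G\<^esub> 0"
proof -
  define i where "i = next_block (x div k)"
  have i: "i < m" using assms by (simp add: i_def less_verts_iff next_block_less)
  have "((m - 1) * k) \<rightarrow>\<^bsub>G\<^esub> 0"
    using k_ge_2 m_ge_2
    by (intro adjI) (auto simp: less_verts_iff mem_out_nbs_iff next_block_def)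
  moreover have "x \<rightarrow>\<^bsub>G\<^esub> (i * k)"
    using assms k_ge_2 by (intro adjI) (auto simp: mem_out_nbs_iff i_def)
  moreover have "(i * k) \<rightarrow>\<^sup>*\<^bsub>G\<^esub> ((m - 1) * k)"
    using i by (intro special_reach) auto
  ultimately show ?thesis
    by (meson adj_reachable_trans reachable_adj_trans)
qed

lemma reach_from_0:
  assumes "x < m * k"
  shows "0 \<rightarrow>\<^sup>*\<^bsub>G\<^esub> x"
proof -
  define i where "i = x div k"
  have i: "i < m" using assms by (simp add: i_def less_verts_iff)
  have *: "0 \<rightarrow>\<^sup>*\<^bsub>G\<^esub> (i * k)" using special_reach[of 0 i] i by simp
  show ?thesis
  proof (cases "k dvd x")
    case True
    then show ?thesis using * by (simp add: i_def)
  next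
    case False
    then have "(i * k) \<rightarrow>\<^bsub>G\<^esub> x"
      using i k_ge_2 by (intro adjI) (auto simp: mem_out_nbs_iff less_verts_iff i_def)
    then show ?thesis using * by (simp add: reachable_adj_trans)
  qed
qed

lemma strongly_connected_G: "strongly_connected G"
proof
  show "verts G \<noteq> {}" using k_ge_2 m_ge_2 by (auto simp: lessThan_empty_iff)
next
  fix x y
  assume "x \<in> verts G" "y \<in> verts G"
  then show "x \<rightarrow>\<^sup>*\<^bsub>G\<^esub> y" by (intro reachable_trans[OF reach_0 reach_from_0]) auto
qed

section \<open>Winding and descents of cycles\<close>

definition crossing :: "nat \<times> nat \<Rightarrow> nat" where
  "crossing e = (if fst e div k = snd e div k then 0 else 1)"

text \<open>An arc between blocks raises the block index by 1, except that leaving the last block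
  also subtracts \<open>m\<close>; precisely the latter arcs descend.\<close>

lemma winding:
  assumes "e \<in> arcs G"
  shows "fst e div k + crossing e = snd e div k + m * descent e"
proof -
  obtain x y where e: "e = (x, y)" by force
  have x: "x div k < m" and y: "y \<in> out_nbs x" using assms by (auto simp: e less_verts_iff)
  show ?thesis
  proof (cases "x div k = y div k")
    case True
    then have "k dvd x" "\<not> k dvd y"
      using y next_block_neq[of "x div k"] by (auto simp: mem_out_nbs_iff)
    then have "x \<noteq> y" by blast
    \<comment> \<open>Being special, \<open>x\<close> is the least vertex of its block, so arcs
      within a block ascend.\<close>
    moreover have "x \<le> y"
      using True \<open>k dvd x\<close> by (metis div_times_less_eq_dividend dvd_div_mult_self)
    ultimately show ?thesis using True by (simp add: e crossing_def descent_def)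
  next
    case False
    then have nb: "y div k = next_block (x div k)" using y by (auto simp: mem_out_nbs_iff)
    show ?thesis
    proof (cases "Suc (x div k) = m")
      case True
      then have "y div k < x div k" using nb m_ge_2 by (simp add: next_block_def)
      then have "\<not> x < y" using div_le_mono[of x y k] by linarith
      then show ?thesis
        using False True nb by (simp add: e crossing_def descent_def next_block_def)
    next
      case False
      then have "x div k < y div k" using nb by (simp add: next_block_def)
      then have "x < y" using div_le_mono[of y x k] by linarith
      then show ?thesis
        using \<open>x div k \<noteq> y div k\<close> False nb by (simp add: e crossing_def descent_def next_block_def)
    qed
  qed
qed

lemma cycle_descents:
  assumes "cycle p"
  shows "0 < sum_list (map descent p)" and "sum_list (map descent p) < k"
proof -
  obtain u where u: "awalk u p u" "distinct (tl (awalk_verts u p))" "p \<noteq> []"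
    using assms by (auto simp: cycle_def)
  then have cas: "cas u p u" and arcs: "set p \<subseteq> arcs G" by (auto simp: awalk_def)
  have dist: "distinct (map snd p)" using u(2) by (simp add: awalk_verts_eq_heads[OF cas])
  show "0 < sum_list (map descent p)"
  proof (rule ccontr)
    assume "\<not> ?thesis"
    then have "\<And>e. e \<in> set p \<Longrightarrow> fst e < snd e"
      by (auto simp: descent_def split: if_splits)
    then have "u < u" using cas_ascending[OF cas \<open>p \<noteq> []\<close>, of "\<lambda>x. x"] by simp
    then show False by simp
  qed
  have sub: "set (map snd p) \<subseteq> {..<m * k}"
    using arcs out_nbs_less by fastforce
  have len: "length p = card (set (map snd p))"
    using distinct_card[OF dist] by simp
  have "length p \<le> m * k"
    using len card_mono[OF _ sub] by simp
  \<comment> \<open>The potential is the block index, whose values at the two ends of the closed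
    walk cancel.\<close>
  have count: "sum_list (map crossing p) = m * sum_list (map descent p)"
    using cas_telescope[OF cas, of "\<lambda>x. x div k" crossing "\<lambda>e. m * descent e"] winding arcs
    by (auto simp: sum_list_const_mult)
  have le_length: "sum_list (map crossing q) \<le> length q" for q
    by (induction q) (auto simp: crossing_def)
  have all_cross: "\<forall>e\<in>set q. crossing e = 1" if "sum_list (map crossing q) = length q" for q
    using that
  proof (induction q)
    case (Cons e q)
    then show ?case
      using le_length[of q] by (cases "fst e div k = snd e div k") (simp_all add: crossing_def[of e])
  qed simp
  show "sum_list (map descent p) < k"
  proof (rule ccontr)
    assume "\<not> ?thesis"
    \<comment> \<open>Crossings are now at least \<open>m * k\<close>, while the number of arcs is
      at most \<open>m * k\<close>: equality holds throughout.\<close>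
    then have "m * k \<le> sum_list (map crossing p)" by (simp add: count)
    with \<open>length p \<le> m * k\<close> le_length[of p]
    have eq: "length p = m * k" "sum_list (map crossing p) = length p" by auto
    have verts: "set (map snd p) = {..<m * k}"
      using sub len eq(1) by (intro card_subset_eq) auto
    \<comment> \<open>Arcs from a special vertex to a nonspecial one stay inside a block, which is
      now excluded.\<close>
    have closed: "k dvd head G e" if "e \<in> set p" "k dvd tail G e" for e
    proof -
      have "crossing e = 1" using all_cross[OF eq(2)] that by auto
      then show ?thesis
        using that arcs by (cases e) (auto simp: crossing_def mem_out_nbs_iff split: if_splits)
    qed
    have "k \<le> m * k" using m_ge_2 by simp
    then have "0 < m * k" "1 < m * k" using k_ge_2 by linarith+
    then have "0 \<in> snd ` set p" "1 \<in> snd ` set p" using verts by auto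
    \<comment> \<open>The cycle visits all vertices, in particular the special vertex 0 and the
      vertex 1, which is not special because \<open>k \<ge> 2\<close>.\<close>
    then obtain e f where "e \<in> set p" "snd e = 0" "f \<in> set p" "snd f = 1" by fastforce
    then have "k dvd head G f"
      using closed_cas_invariant[OF cas, of e f "\<lambda>x. k dvd x"] closed by auto
    then show False using \<open>snd f = 1\<close> k_ge_2 by simp
  qed
qed

lemma no_zero_sum_cycle: "\<not> zero_sum_cycle k G (\<lambda>e. int (descent e)) p"
proof
  assume "zero_sum_cycle k G (\<lambda>e. int (descent e)) p"
  then have cyc: "cycle p" and zero: "label_sum k (\<lambda>e. int (descent e)) p = 0"
    by (auto simp: zero_sum_cycle_def)
  define s where "s = sum_list (map descent p)"
  have "sum_list (map (\<lambda>e. int (descent e)) p) = int s"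
    unfolding s_def by (induction p) auto
  then have "int s mod int k = 0"
    using zero k_ge_2 by (simp add: label_sum_eq_sum_list)
  \<comment> \<open>No multiple of \<open>k\<close> lies strictly between 0 and
    \<open>k\<close>.\<close>
  then show False using cycle_descents[OF cyc] by (simp flip: s_def)
qed

lemma edge_labelling_descent: "edge_labelling k G (\<lambda>e. int (descent e))"
  using k_ge_2 by (auto simp: edge_labelling_def carrier_integer_mod_group descent_def)

end

theorem proposition6p2:
  fixes k m :: nat
  assumes "k \<ge> 2" and "m \<ge> 2"
  shows "\<exists>(G :: (nat, nat \<times> nat) pre_digraph) (w :: nat \<times> nat \<Rightarrow> int).
           digraph G \<and> strongly_connected G \<and> regular_digraph k G \<and>
           card (verts G) = m * k \<and>
           edge_labelling k G w \<and> \<not> (\<exists>p. zero_sum_cycle k G w p)"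
proof -
  interpret block_cycle k m using assms by unfold_locales
  show ?thesis
    using digraph_G strongly_connected_G regular_digraph_G edge_labelling_descent no_zero_sum_cycle
    by (intro exI[of _ G] exI[of _ "\<lambda>e. int (descent e)"]) simp
qed

end
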